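(* Let $G$ be a connected undirected unweighted network with Laplacian matrix $Q$, let $\epsilon$, $R$, $\lambda_1(R)$ and $z$ be as defined in the context, and let $\Delta Q$ be the Laplacian matrix of an added subgraph consisting of $K$ links. Then the function $$\mathcal{E}(\Delta Q)=z^T\Delta Q\,z-\frac{\epsilon}{\lambda_1(R)}\,z^T(\Delta Q)^2z$$ is bounded by $$\delta\, z^T\Delta Q\,z\ \le\ \mathcal{E}(\Delta Q)\ \le\ z^T\Delta Q\,z,$$ where $\delta:=1-\frac{\epsilon}{\lambda_1(R)}(K+1)$.
   Context: $G$ has $N$ nodes, adjacency matrix $A$ with entries in $\{0,1\}$ (symmetric, zero diagonal), diagonal degree matrix $\Delta=\mathrm{diag}(d_1,\dots,d_N)$, and Laplacian $Q=\Delta-A$. The eigenvalues of $Q$ are assumed distinct. $I_N$ is the identity matrix and $J$ is the $N\times N$ all-ones matrix. The number $\epsilon>0$ is sufficiently small, in particular $\epsilon<1/d_{\max}$ with $d_{\max}$ the maximum degree. Set $R=I_N-\epsilon Q-\frac1N J$; $\lambda_1(R)$ is its largest eigenvalue and $z$ (normalized by $\|z\|_2=1$) is the eigenvector of $R$ belonging to $\lambda_1(R)$. An added subgraph is a set of links (pairs of distinct nodes not already joined in $G$), and $\Delta Q$ is the Laplacian matrix of the graph on the same $N$ nodes composed of exactly these links. *)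

theory Defs
  imports "HOL-Analysis.Analysis"
begin

(* A network is given by its set of links; the nodes are the elements of the finite
   type 'n, so that N = CARD('n). *)
definition is_link_set :: "'n set set \<Rightarrow> bool" where
  "is_link_set E \<longleftrightarrow> (\<forall>e\<in>E. card e = 2)"

definition connected_network :: "'n set set \<Rightarrow> bool" where
  "connected_network E \<longleftrightarrow> (\<forall>i j. (i, j) \<in> {(u, v). {u, v} \<in> E}\<^sup>*)"

definition adjacency_matrix :: "'n::finite set set \<Rightarrow> real ^ 'n ^ 'n" where
  "adjacency_matrix E = (\<chi> i j. if {i, j} \<in> E then 1 else 0)"

definition node_degree :: "'n::finite set set \<Rightarrow> 'n \<Rightarrow> nat" where
  "node_degree E i = card {j. {i, j} \<in> E}"

definition max_degree :: "'n::finite set set \<Rightarrow> nat" where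
  "max_degree E = Max (range (node_degree E))"

definition degree_matrix :: "'n::finite set set \<Rightarrow> real ^ 'n ^ 'n" where
  "degree_matrix E = (\<chi> i j. if i = j then real (node_degree E i) else 0)"

definition laplacian :: "'n::finite set set \<Rightarrow> real ^ 'n ^ 'n" where
  "laplacian E = degree_matrix E - adjacency_matrix E"

definition eigenvector :: "real ^ 'n ^ 'n \<Rightarrow> real ^ 'n \<Rightarrow> real \<Rightarrow> bool" where
  "eigenvector A v k \<longleftrightarrow> v \<noteq> 0 \<and> A *v v = k *\<^sub>R v"

definition eigenvalues :: "real ^ 'n ^ 'n \<Rightarrow> real set" where
  "eigenvalues A = {k. \<exists>v. eigenvector A v k}"

(* Intended for symmetric matrices: their N eigenvalues are real, and they are pairwise
   distinct exactly when the set of eigenvalues has N elements. *)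
definition distinct_eigenvalues :: "real ^ 'n ^ 'n \<Rightarrow> bool" where
  "distinct_eigenvalues A \<longleftrightarrow> card (eigenvalues A) = CARD('n)"

(* Intended for symmetric matrices, whose set of eigenvalues is finite and nonempty. *)
definition largest_eigenvalue :: "real ^ 'n ^ 'n \<Rightarrow> real" where
  "largest_eigenvalue A = Max (eigenvalues A)"

definition all_ones :: "real ^ 'n ^ 'n" where
  "all_ones = (\<chi> i j. 1)"

definition R_matrix :: "real \<Rightarrow> 'n::finite set set \<Rightarrow> real ^ 'n ^ 'n" where
  "R_matrix \<epsilon> E =
     mat 1 - \<epsilon> *\<^sub>R laplacian E - (1 / real CARD('n)) *\<^sub>R all_ones"

definition quad_form :: "real ^ 'n ^ 'n \<Rightarrow> real ^ 'n \<Rightarrow> real" where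
  "quad_form M z = z \<bullet> (M *v z)"

definition gain :: "real \<Rightarrow> 'n::finite set set \<Rightarrow> real ^ 'n \<Rightarrow> real ^ 'n ^ 'n \<Rightarrow> real" where
  "gain \<epsilon> E z M =
     quad_form M z - \<epsilon> / largest_eigenvalue (R_matrix \<epsilon> E) * quad_form (M ** M) z"

end

theory Submission
  imports Defs
begin

text \<open>
  Put \<open>M\<close> for the Laplacian of the added links and \<open>\<lambda>\<close> for the largest eigenvalue of \<open>R\<close>.  As
  \<open>M\<close> is symmetric, \<open>z\<^sup>T M\<^sup>2 z\<close> is the squared norm of \<open>M z\<close>, so both bounds follow from
  \<open>0 \<le> \<lambda>\<close> and \<open>\<parallel>M z\<parallel>\<^sup>2 \<le> (K + 1) z\<^sup>T M z\<close>.

  The sign of \<open>\<lambda>\<close>: the all-ones vector is annihilated by \<open>Q\<close> and fixed by \<open>J / N\<close>, hence it lies in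
  the kernel of \<open>R\<close>.  So \<open>0\<close> is an eigenvalue of \<open>R\<close>
  (\<open>zero_eigenvalue_R_matrix\<close>), and the largest eigenvalue, a maximum over a finite set
  (\<open>finite_eigenvalues_symmetric\<close>), cannot be smaller.  The value \<open>\<lambda> = 0\<close> does no harm: the quotient
  \<open>\<epsilon> / \<lambda>\<close> then takes the default value \<open>0\<close>, and the three terms of the claim coincide.

  The quadratic inequality says that the eigenvalues of the Laplacian of a network with \<open>K\<close> links are
  at most \<open>K + 1\<close>, with equality for a star.  Write \<open>M\<close> as the sum of \<open>b\<^sub>e b\<^sub>e\<^sup>T\<close> over the links,
  where \<open>b\<^sub>e\<close> is the difference of the two unit vectors at the ends of \<open>e\<close>
  (\<open>laplacian_mult_vec\<close>).  With \<open>y\<^sub>e = b\<^sub>e \<bullet> z\<close> one has \<open>z\<^sup>T M z = \<Sum> y\<^sub>e\<^sup>2\<close> and \<open>M z = \<Sum> y\<^sub>e b\<^sub>e\<close>.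
  The Gram matrix of the \<open>b\<^sub>e\<close> has diagonal \<open>2\<close> and off-diagonal entries of modulus at most \<open>1\<close>, since
  distinct links share at most one node, and its absolute row sums are therefore at most
  \<open>2 + (K - 1)\<close>; this bounds \<open>\<parallel>M z\<parallel>\<^sup>2\<close> by \<open>(K + 1) \<Sum> y\<^sub>e\<^sup>2\<close> (\<open>norm_sum_le_Gram\<close>).
\<close>

section \<open>Eigenvalues of symmetric matrices\<close>

lemma symmetric_matrix_inner:
  fixes A :: "real ^ 'n ^ 'n"
  assumes "transpose A = A"
  shows "(A *v x) \<bullet> y = x \<bullet> (A *v y)"
  using dot_lmul_matrix[of x A y] transpose_matrix_vector[of A x] assms by simp

text \<open>
  Eigenvectors of a symmetric matrix for different eigenvalues are orthogonal, and a family of nonzero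
  pairwise orthogonal vectors is linearly independent, so in finite dimension it is finite.
\<close>

lemma finite_eigenvalues_symmetric:
  fixes A :: "real ^ 'n ^ 'n"
  assumes sym: "transpose A = A"
  shows "finite (eigenvalues A)"
proof -
  obtain v where v: "eigenvector A (v k) k" if "k \<in> eigenvalues A" for k
  proof -
    have "\<forall>k\<in>eigenvalues A. \<exists>v. eigenvector A v k"
      by (simp add: eigenvalues_def)
    from bchoice[OF this] show ?thesis
      using that by blast
  qed
  have nz: "v k \<noteq> 0" if "k \<in> eigenvalues A" for k
    using v[OF that] by (simp add: eigenvector_def)
  have orth: "v k \<bullet> v l = 0" if "k \<in> eigenvalues A" "l \<in> eigenvalues A" "k \<noteq> l" for k l
  proof -
    have "k * (v k \<bullet> v l) = (A *v v k) \<bullet> v l"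
      using v[OF that(1)] by (simp add: eigenvector_def)
    also have "\<dots> = v k \<bullet> (A *v v l)"
      by (rule symmetric_matrix_inner[OF sym])
    also have "\<dots> = l * (v k \<bullet> v l)"
      using v[OF that(2)] by (simp add: eigenvector_def)
    finally show ?thesis using that(3) by simp
  qed
  have "pairwise orthogonal (v ` eigenvalues A)"
    unfolding pairwise_def orthogonal_def using orth by auto
  moreover have "0 \<notin> v ` eigenvalues A"
    using nz by auto
  ultimately have "finite (v ` eigenvalues A)"
    by (intro finiteI_independent pairwise_orthogonal_independent)
  moreover have "inj_on v (eigenvalues A)"
    by (rule inj_onI) (metis orth nz inner_eq_zero_iff)
  ultimately show ?thesis
    by (rule finite_imageD)
qed

section \<open>The Laplacian as an operator\<close>

lemma transpose_laplacian: "transpose (laplacian E) = laplacian E"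
  by (simp add: transpose_def laplacian_def degree_matrix_def adjacency_matrix_def
        vec_eq_iff insert_commute)

lemma laplacian_mult_vec_component:
  "(laplacian E *v x) $ i = (\<Sum>j | {i, j} \<in> E. x $ i - x $ j)"
proof -
  have "(laplacian E *v x) $ i =
      (\<Sum>j\<in>UNIV. (if i = j then real (node_degree E i) * x $ i else 0) -
                (if {i, j} \<in> E then x $ j else 0))"
    unfolding matrix_vector_mult_def laplacian_def degree_matrix_def adjacency_matrix_def
    by (auto simp: algebra_simps intro!: sum.cong)
  also have "\<dots> = real (node_degree E i) * x $ i - (\<Sum>j | {i, j} \<in> E. x $ j)"
    by (simp add: sum_subtractf sum.If_cases)
  also have "\<dots> = (\<Sum>j | {i, j} \<in> E. x $ i - x $ j)"
    by (simp add: sum_subtractf node_degree_def)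
  finally show ?thesis .
qed

lemma transpose_R_matrix: "transpose (R_matrix \<epsilon> E) = R_matrix \<epsilon> E"
proof -
  have "laplacian E $ j $ i = laplacian E $ i $ j" for i j
  proof -
    have "transpose (laplacian E) $ i $ j = laplacian E $ i $ j"
      by (simp only: transpose_laplacian)
    then show ?thesis
      by (simp add: transpose_def)
  qed
  then show ?thesis
    by (simp add: transpose_def R_matrix_def all_ones_def mat_def vec_eq_iff)
qed

text \<open>
  The all-ones vector is an eigenvector: the identity and \<open>J / N\<close> both fix it, and the rows of a
  Laplacian sum to zero.
\<close>

lemma zero_eigenvalue_R_matrix: "0 \<in> eigenvalues (R_matrix \<epsilon> E)"
proof -
  have Q: "(\<epsilon> *\<^sub>R laplacian E) *v (\<chi> i. 1) = 0"
    unfolding scaleR_matrix_vector_assoc[symmetric]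
    by (simp add: vec_eq_iff laplacian_mult_vec_component)
  have J: "((1 / real CARD('a)) *\<^sub>R (all_ones :: real ^ 'a ^ 'a)) *v (\<chi> i. 1) = (\<chi> i. 1)"
    by (simp add: vec_eq_iff all_ones_def matrix_vector_mult_def)
  have "R_matrix \<epsilon> E *v (\<chi> i. 1) = 0"
    unfolding R_matrix_def matrix_vector_mult_diff_rdistrib Q J by simp
  then have "eigenvector (R_matrix \<epsilon> E) (\<chi> i. 1) 0"
    by (simp add: eigenvector_def vec_eq_iff)
  then show ?thesis
    by (auto simp: eigenvalues_def)
qed

lemma largest_eigenvalue_R_matrix_nonneg: "0 \<le> largest_eigenvalue (R_matrix \<epsilon> E)"
  unfolding largest_eigenvalue_def
  by (rule Max_ge[OF finite_eigenvalues_symmetric[OF transpose_R_matrix] zero_eigenvalue_R_matrix])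

section \<open>Incidence vectors and the spectral bound\<close>

text \<open>
  A column of the oriented incidence matrix.  Each link is oriented by an arbitrary choice; the sign
  cancels in every use, where a vector occurs twice or in absolute value.
\<close>

definition incidence_vector :: "'n::finite set \<Rightarrow> real ^ 'n" where
  "incidence_vector e =
     (SOME b. \<exists>i j. i \<noteq> j \<and> e = {i, j} \<and> b = axis i 1 - axis j 1)"

lemma incidence_vectorE:
  assumes "card e = 2"
  obtains i j where "i \<noteq> j" "e = {i, j}" "incidence_vector e = axis i 1 - axis j 1"
proof -
  obtain i j where "e = {i, j}" "i \<noteq> j"
    using assms unfolding card_2_iff by blast
  then have "\<exists>b :: real ^ 'a. \<exists>i j. i \<noteq> j \<and> e = {i, j} \<and> b = axis i 1 - axis j 1"
    by blast
  from someI_ex[OF this] show ?thesis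
    using that unfolding incidence_vector_def by blast
qed

lemma incidence_vector_inner_self:
  assumes "card e = 2"
  shows "incidence_vector e \<bullet> incidence_vector e = 2"
  by (rule incidence_vectorE[OF assms]) (simp add: inner_diff_left inner_diff_right inner_axis_axis)

lemma incidence_vector_inner_le_1:
  assumes "card e = 2" "card f = 2" "e \<noteq> f"
  shows "\<bar>incidence_vector e \<bullet> incidence_vector f\<bar> \<le> 1"
proof -
  obtain i j where e: "i \<noteq> j" "e = {i, j}" "incidence_vector e = axis i 1 - axis j 1"
    using incidence_vectorE[OF assms(1)] .
  obtain k l where f: "k \<noteq> l" "f = {k, l}" "incidence_vector f = axis k 1 - axis l 1"
    using incidence_vectorE[OF assms(2)] .
  show ?thesis
    using e(1,2) f(1,2) assms(3) unfolding e(3) f(3)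
    by (auto simp: inner_diff_left inner_diff_right inner_axis_axis)
qed

text \<open>
  Reversing the orientation of the link changes the sign of both factors on the left, which is why the
  right-hand side does not depend on the choice.
\<close>

lemma incidence_vector_component:
  fixes x :: "real ^ 'n"
  assumes "card {i, j} = 2"
  shows "(incidence_vector {i, j} \<bullet> x) * incidence_vector {i, j} $ i = x $ i - x $ j"
proof -
  obtain k l where kl: "k \<noteq> l" "{i, j} = {k, l}"
      "incidence_vector {i, j} = axis k 1 - axis l 1"
    using incidence_vectorE[OF assms] .
  from kl(2) consider "k = i" "l = j" | "k = j" "l = i"
    by (auto simp: doubleton_eq_iff)
  then show ?thesis
    using kl(1) unfolding kl(3)
    by cases (simp_all add: inner_diff_left inner_axis', simp_all add: axis_def)
qed

lemma incidence_vector_component_outside: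
  assumes "card e = 2" "i \<notin> e"
  shows "incidence_vector e $ i = 0"
  by (rule incidence_vectorE[OF assms(1)]) (use assms(2) in \<open>auto simp: axis_def\<close>)

text \<open>
  The factorization of the Laplacian into the incidence matrix and its transpose.  At node \<open>i\<close> only
  the links through \<open>i\<close> contribute, and these correspond to the neighbours \<open>j\<close> of \<open>i\<close>.
\<close>

lemma laplacian_mult_vec:
  fixes z :: "real ^ 'n"
  assumes L: "is_link_set L"
  shows "laplacian L *v z = (\<Sum>e\<in>L. (incidence_vector e \<bullet> z) *\<^sub>R incidence_vector e)"
proof (rule vec_eq_iff[THEN iffD2], rule allI)
  fix i
  let ?t = "\<lambda>e. (incidence_vector e \<bullet> z) * incidence_vector e $ i"
  have card2: "card e = 2" if "e \<in> L" for e
    using L that by (simp add: is_link_set_def)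
  have image: "(\<lambda>j. {i, j}) ` {j. {i, j} \<in> L} = {e \<in> L. i \<in> e}"
  proof (intro equalityI subsetI)
    fix e assume e: "e \<in> {e \<in> L. i \<in> e}"
    then have "card e = 2"
      using card2 by blast
    then obtain a b where "e = {a, b}"
      unfolding card_2_iff by blast
    then show "e \<in> (\<lambda>j. {i, j}) ` {j. {i, j} \<in> L}"
      using e by (auto simp: insert_commute image_iff)
  qed auto
  have inj: "inj_on (\<lambda>j. {i, j}) {j. {i, j} \<in> L}"
    by (auto simp: inj_on_def doubleton_eq_iff)
  have "(\<Sum>e\<in>L. (incidence_vector e \<bullet> z) *\<^sub>R incidence_vector e) $ i = (\<Sum>e\<in>L. ?t e)"
    by (simp add: sum_component)
  also have "\<dots> = (\<Sum>e | e \<in> L \<and> i \<in> e. ?t e)"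
    by (rule sum.mono_neutral_right) (auto simp: card2 incidence_vector_component_outside)
  also have "\<dots> = (\<Sum>j | {i, j} \<in> L. ?t {i, j})"
    using sum.reindex[OF inj, of ?t] by (simp add: image)
  also have "\<dots> = (\<Sum>j | {i, j} \<in> L. z $ i - z $ j)"
    by (intro sum.cong refl incidence_vector_component) (simp add: card2)
  finally show "(laplacian L *v z) $ i =
      (\<Sum>e\<in>L. (incidence_vector e \<bullet> z) *\<^sub>R incidence_vector e) $ i"
    by (simp add: laplacian_mult_vec_component)
qed

lemma quad_form_laplacian:
  assumes "is_link_set L"
  shows "quad_form (laplacian L) z = (\<Sum>e\<in>L. (incidence_vector e \<bullet> z)\<^sup>2)"
  unfolding quad_form_def laplacian_mult_vec[OF assms]
  by (simp add: inner_sum_right power2_eq_square inner_commute)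

text \<open>
  The largest eigenvalue of a Gram matrix is at most its largest absolute row sum, here at most
  \<open>2 + (card L - 1)\<close>.  Splitting each product \<open>\<bar>y\<^sub>e y\<^sub>f\<bar>\<close> by the inequality between the arithmetic
  and the geometric mean gives \<open>card L\<close> times the sum of squares if every Gram entry is counted as
  at most \<open>1\<close>; the excess of the diagonal adds that sum once more.
\<close>

lemma norm_sum_le_Gram:
  fixes b :: "'a \<Rightarrow> 'b::real_inner" and y :: "'a \<Rightarrow> real"
  assumes diag: "\<And>e. e \<in> L \<Longrightarrow> b e \<bullet> b e \<le> 2"
    and off: "\<And>e f. e \<in> L \<Longrightarrow> f \<in> L \<Longrightarrow> e \<noteq> f \<Longrightarrow> \<bar>b e \<bullet> b f\<bar> \<le> 1"
    and fin: "finite L"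
  shows "(norm (\<Sum>e\<in>L. y e *\<^sub>R b e))\<^sup>2 \<le> (real (card L) + 1) * (\<Sum>e\<in>L. (y e)\<^sup>2)"
proof -
  have bound: "y e * (y f * (b e \<bullet> b f))
      \<le> ((y e)\<^sup>2 + (y f)\<^sup>2) / 2 + (if e = f then (y e)\<^sup>2 else 0)"
    if "e \<in> L" "f \<in> L" for e f
  proof (cases "e = f")
    case True
    have "(y e)\<^sup>2 * (b e \<bullet> b e) \<le> (y e)\<^sup>2 * 2"
      using diag[OF that(1)] by (rule mult_left_mono) simp
    then show ?thesis
      using True by (simp add: power2_eq_square mult.assoc)
  next
    case False
    have "y e * (y f * (b e \<bullet> b f)) \<le> \<bar>y e * y f\<bar> * \<bar>b e \<bullet> b f\<bar>"
      by (metis abs_ge_self abs_mult mult.assoc)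
    also have "\<dots> \<le> \<bar>y e * y f\<bar>"
      using off[OF that False] by (simp add: mult_left_le)
    also have "\<dots> \<le> ((y e)\<^sup>2 + (y f)\<^sup>2) / 2"
      using sum_squares_bound[of "\<bar>y e\<bar>" "\<bar>y f\<bar>"] by (simp add: abs_mult)
    finally show ?thesis
      using False by simp
  qed
  have "(norm (\<Sum>e\<in>L. y e *\<^sub>R b e))\<^sup>2 = (\<Sum>e\<in>L. \<Sum>f\<in>L. y e * (y f * (b e \<bullet> b f)))"
    by (simp add: power2_norm_eq_inner inner_sum_left inner_sum_right)
      (intro sum.cong refl, simp add: inner_commute sum_distrib_left)
  also have "\<dots> \<le> (\<Sum>e\<in>L. \<Sum>f\<in>L. ((y e)\<^sup>2 + (y f)\<^sup>2) / 2 + (if e = f then (y e)\<^sup>2 else 0))"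
    by (intro sum_mono bound)
  also have "\<dots> = (real (card L) + 1) * (\<Sum>e\<in>L. (y e)\<^sup>2)"
    using fin
    by (simp add: sum.distrib sum_divide_distrib[symmetric] sum_distrib_left[symmetric]
        algebra_simps)
  finally show ?thesis .
qed

lemma norm_laplacian_mult_vec_le:
  assumes L: "is_link_set L"
  shows "(norm (laplacian L *v z))\<^sup>2 \<le> (real (card L) + 1) * quad_form (laplacian L) z"
  unfolding quad_form_laplacian[OF L] laplacian_mult_vec[OF L]
  by (rule norm_sum_le_Gram)
    (use L in \<open>auto simp: is_link_set_def incidence_vector_inner_self incidence_vector_inner_le_1\<close>)

lemma quad_form_laplacian_square:
  "quad_form (laplacian L ** laplacian L) z = (norm (laplacian L *v z))\<^sup>2"
  by (simp add: quad_form_def power2_norm_eq_inner symmetric_matrix_inner transpose_laplacian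
      flip: matrix_vector_mul_assoc)

section \<open>The bounds on the gain\<close>

theorem lemma2:
  fixes E L :: "'n::finite set set" and \<epsilon> \<delta> :: real and z :: "real ^ 'n" and K :: nat
  assumes "is_link_set E"
    and "connected_network E"
    and "distinct_eigenvalues (laplacian E)"
    and "0 < \<epsilon>"
    and "0 < max_degree E \<longrightarrow> \<epsilon> < 1 / real (max_degree E)"
    and "eigenvector (R_matrix \<epsilon> E) z (largest_eigenvalue (R_matrix \<epsilon> E))"
    and "norm z = 1"
    and "is_link_set L"
    and "L \<inter> E = {}"
    and "card L = K"
    and "\<delta> = 1 - \<epsilon> / largest_eigenvalue (R_matrix \<epsilon> E) * (real K + 1)"
  shows "\<delta> * quad_form (laplacian L) z \<le> gain \<epsilon> E z (laplacian L)
    \<and> gain \<epsilon> E z (laplacian L) \<le> quad_form (laplacian L) z"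
proof -
  define c where "c = \<epsilon> / largest_eigenvalue (R_matrix \<epsilon> E)"
  define q where "q = quad_form (laplacian L) z"
  define s where "s = (norm (laplacian L *v z))\<^sup>2"
  have "0 \<le> c"
    using \<open>0 < \<epsilon>\<close> largest_eigenvalue_R_matrix_nonneg[of \<epsilon> E] by (simp add: c_def)
  moreover have "s \<le> (real K + 1) * q"
    using norm_laplacian_mult_vec_le[OF \<open>is_link_set L\<close>, of z] \<open>card L = K\<close>
    by (simp add: s_def q_def)
  ultimately have "c * s \<le> c * ((real K + 1) * q)" and "0 \<le> c * s"
    by (simp_all add: mult_left_mono s_def)
  moreover have "gain \<epsilon> E z (laplacian L) = q - c * s"
    by (simp add: gain_def c_def q_def s_def quad_form_laplacian_square)
  moreover have "\<delta> * q = q - c * ((real K + 1) * q)"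
    unfolding assms(11) c_def[symmetric] by (simp add: algebra_simps)
  ultimately show ?thesis
    by (simp add: q_def)
qed

end
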